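(* Let $m\ge 4$ and $n\ge 1$, and let $T$ be a triangulation of the grid-covered cylinder graph $G_{m,n}$. Then $T$ is word-representable if and only if $T$ contains neither the wheel graph $W_5$ nor the wheel graph $W_7$ as an induced subgraph.
   Context: A simple graph $G=(V,E)$ is word-representable if there is a word $w$ over the alphabet $V$, containing every letter of $V$, such that for all distinct $x,y\in V$, the letters $x$ and $y$ alternate in $w$ (deleting all other letters leaves $xyxy\cdots$ or $yxyx\cdots$) if and only if $xy\in E$. The grid-covered cylinder graph $G_{m,n}$ ($m$ sectors, $n$ layers) has vertex set $\{v_{ij}: 0\le i\le n,\ 0\le j\le m-1\}$ and edges $v_{ij}v_{i,j+1}$ (horizontal edges, second index mod $m$) and $v_{ij}v_{i+1,j}$ for $0\le i\le n-1$ (vertical edges). Its cells are the $mn$ 4-cycles $v_{ij}v_{i+1,j}v_{i+1,j+1}v_{i,j+1}$ ($0\le i\le n-1$, $0\le j\le m-1$, second index mod $m$). A triangulation of $G_{m,n}$ is a graph obtained from $G_{m,n}$ by adding, in each cell, exactly one of its two diagonals as an edge. For $k\ge 3$, the wheel graph $W_k$ is the cycle $C_k$ together with an extra vertex adjacent to all vertices of the cycle. *)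

theory Defs
  imports "Graph_Theory.Digraph_Isomorphism"
begin

text \<open>As usual in \<^theory>\<open>Graph_Theory.Digraph\<close>, an undirected simple graph is a symmetric
  loop-free digraph whose arcs are ordered pairs of vertices (locale \<^locale>\<open>pair_graph\<close>).
  Edge sets are written below as sets of two-element sets \<open>{u, v}\<close>.\<close>

definition undirected :: "'a set \<Rightarrow> 'a set set \<Rightarrow> 'a pair_pre_digraph" where
  "undirected V E = \<lparr> pverts = V, parcs = {(u, v). {u, v} \<in> E} \<rparr>"

lemma pverts_undirected [simp]: "pverts (undirected V E) = V"
  and parcs_undirected [simp]: "(u, v) \<in> parcs (undirected V E) \<longleftrightarrow> {u, v} \<in> E"
  by (simp_all add: undirected_def)

lemma pair_graph_undirected:
  assumes "finite V" and "\<And>e. e \<in> E \<Longrightarrow> e \<subseteq> V \<and> card e = 2"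
  shows "pair_graph (undirected V E)"
proof -
  have sub: "parcs (undirected V E) \<subseteq> V \<times> V"
    using assms(2) by (auto simp: undirected_def)
  have fin: "finite (parcs (undirected V E))"
    by (rule finite_subset[OF sub]) (simp add: assms(1))
  have sym: "symmetric (with_proj (undirected V E))"
    by (auto simp: symmetric_def sym_def insert_commute)
  have loop: "u \<noteq> v" if "{u, v} \<in> E" for u v
    using assms(2)[OF that] by auto
  show ?thesis
    using sub fin sym loop assms(1) by unfold_locales auto
qed

definition add_edges :: "'a pair_pre_digraph \<Rightarrow> 'a set set \<Rightarrow> 'a pair_pre_digraph" where
  "add_edges G F = \<lparr> pverts = pverts G, parcs = parcs G \<union> {(u, v). {u, v} \<in> F} \<rparr>"

lemma add_edges_undirected: "add_edges (undirected V E) F = undirected V (E \<union> F)"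
  by (auto simp: add_edges_def undirected_def)


subsection \<open>Word-representability\<close>

definition alternating_word :: "'a \<Rightarrow> 'a \<Rightarrow> nat \<Rightarrow> 'a list" where
  "alternating_word x y l = map (\<lambda>i. if even i then x else y) [0..<l]"

definition alternate_in :: "'a list \<Rightarrow> 'a \<Rightarrow> 'a \<Rightarrow> bool" where
  "alternate_in w x y \<longleftrightarrow>
     (\<exists>l. filter (\<lambda>z. z \<in> {x, y}) w \<in> {alternating_word x y l, alternating_word y x l})"

definition word_representable :: "'a pair_pre_digraph \<Rightarrow> bool" where
  "word_representable G \<longleftrightarrow>
     (\<exists>w. set w = pverts G \<and>
        (\<forall>x \<in> pverts G. \<forall>y \<in> pverts G. x \<noteq> y \<longrightarrow>
           (alternate_in w x y \<longleftrightarrow> (x, y) \<in> parcs G)))"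


subsection \<open>Triangulations of grid-covered cylinder graphs\<close>

text \<open>The vertex \<open>v\<^sub>i\<^sub>j\<close> is the pair \<open>(i, j)\<close>.\<close>

definition cylinder_verts :: "nat \<Rightarrow> nat \<Rightarrow> (nat \<times> nat) set" where
  "cylinder_verts m n = {(i, j). i \<le> n \<and> j < m}"

definition cylinder_edges :: "nat \<Rightarrow> nat \<Rightarrow> (nat \<times> nat) set set" where
  "cylinder_edges m n =
     {{(i, j), (i, (j + 1) mod m)} | i j. i \<le> n \<and> j < m} \<union>
     {{(i, j), (i + 1, j)} | i j. i < n \<and> j < m}"

definition cylinder_graph :: "nat \<Rightarrow> nat \<Rightarrow> (nat \<times> nat) pair_pre_digraph" where
  "cylinder_graph m n = undirected (cylinder_verts m n) (cylinder_edges m n)"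

text \<open>The cell \<open>v\<^sub>i\<^sub>,\<^sub>j v\<^sub>i\<^sub>+\<^sub>1\<^sub>,\<^sub>j v\<^sub>i\<^sub>+\<^sub>1\<^sub>,\<^sub>j\<^sub>+\<^sub>1 v\<^sub>i\<^sub>,\<^sub>j\<^sub>+\<^sub>1\<close>
  is named by its corner \<open>(i, j)\<close>.\<close>

definition cells :: "nat \<Rightarrow> nat \<Rightarrow> (nat \<times> nat) set" where
  "cells m n = {(i, j). i < n \<and> j < m}"

definition cell_diagonals :: "nat \<Rightarrow> nat \<times> nat \<Rightarrow> (nat \<times> nat) set set" where
  "cell_diagonals m = (\<lambda>(i, j).
     {{(i, j), (i + 1, (j + 1) mod m)}, {(i + 1, j), (i, (j + 1) mod m)}})"

definition triangulation :: "nat \<Rightarrow> nat \<Rightarrow> (nat \<times> nat) pair_pre_digraph \<Rightarrow> bool" where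
  "triangulation m n T \<longleftrightarrow>
     (\<exists>d. (\<forall>c \<in> cells m n. d c \<in> cell_diagonals m c) \<and>
          T = add_edges (cylinder_graph m n) (d ` cells m n))"

lemma mod_Suc_neq:
  assumes "2 \<le> m" "j < m"
  shows "j \<noteq> Suc j mod m"
  using assms by (auto simp: mod_Suc)

lemma pair_graph_triangulation:
  assumes "2 \<le> m" "triangulation m n T"
  shows "pair_graph T"
proof -
  obtain d where d: "\<And>c. c \<in> cells m n \<Longrightarrow> d c \<in> cell_diagonals m c"
    and T: "T = undirected (cylinder_verts m n) (cylinder_edges m n \<union> d ` cells m n)"
    using assms(2) by (auto simp: triangulation_def cylinder_graph_def add_edges_undirected)
  have "cylinder_verts m n = {..n} \<times> {..<m}"
    by (auto simp: cylinder_verts_def)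
  then have fin: "finite (cylinder_verts m n)"
    by simp
  have diag: "e \<subseteq> cylinder_verts m n \<and> card e = 2"
    if "c \<in> cells m n" "e \<in> cell_diagonals m c" for c e
    using that assms(1) by (auto simp: cells_def cell_diagonals_def cylinder_verts_def)
  have grid: "e \<subseteq> cylinder_verts m n \<and> card e = 2" if "e \<in> cylinder_edges m n" for e
    using that assms(1) by (auto simp: cylinder_edges_def cylinder_verts_def mod_Suc_neq)
  show ?thesis
    unfolding T using fin diag grid d by (intro pair_graph_undirected) blast+
qed


subsection \<open>Wheels and induced subgraphs\<close>

text \<open>The rim of \<open>W\<^sub>k\<close> is the cycle on \<open>0, \<dots>, k - 1\<close>; its hub is \<open>k\<close>.\<close>

definition wheel_graph :: "nat \<Rightarrow> nat pair_pre_digraph" where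
  "wheel_graph k = undirected {..k}
     ({{i, (i + 1) mod k} | i. i < k} \<union> {{i, k} | i. i < k})"

lemma pair_graph_wheel_graph:
  assumes "3 \<le> k"
  shows "pair_graph (wheel_graph k)"
  unfolding wheel_graph_def
proof (rule pair_graph_undirected)
  fix e assume "e \<in> {{i, (i + 1) mod k} | i. i < k} \<union> {{i, k} | i. i < k}"
  then show "e \<subseteq> {..k} \<and> card e = 2"
    using assms by (auto simp: mod_Suc_neq intro: less_imp_le)
qed simp

definition contains_induced :: "'a pair_pre_digraph \<Rightarrow> 'b pair_pre_digraph \<Rightarrow> bool" where
  "contains_induced G H \<longleftrightarrow>
     (\<exists>S \<subseteq> pverts G. digraph_iso (with_proj H) (induce_subgraph (with_proj G) S))"

end

theory Submission
  imports Defs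
begin

text \<open>
  In a word that represents a graph, record for each neighbour \<open>x\<close> of a vertex \<open>h\<close> the set of
  prefixes in which \<open>x\<close> is ahead of \<open>h\<close>: two neighbours of \<open>h\<close> alternate iff these sets are comparable
  by inclusion.  As an odd cycle of length at least 5 is not a comparability graph, odd wheels are excluded.

  Conversely, the link of an interior vertex of the triangulation is an induced cycle, so without \<open>W\<^sub>5\<close>
  and \<open>W\<^sub>7\<close> all interior degrees are even.  This makes the choice of the diagonals separable: there are
  signs \<open>v\<^sub>i\<close> and \<open>h\<^sub>j\<close> such that the cell \<open>(i, j)\<close> has the diagonal through \<open>(i, j)\<close> iff \<open>v\<^sub>i = h\<^sub>j\<close>.  With
  the partial sums \<open>X\<^sub>i\<close> of the \<open>v\<^sub>i\<close> and \<open>K\<^sub>j\<close> of numbers \<open>\<delta>\<^sub>j \<in> {h\<^sub>j, 2}\<close> chosen such that their total is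
  \<open>0\<close> modulo 4, the residue of \<open>X\<^sub>i + K\<^sub>j\<close> modulo 4 is a proper colouring without a 4-cycle coloured
  \<open>0, 1, 2, 3\<close> in this order.  Orienting the edges towards the larger colour is then semi-transitive, and
  semi-transitively orientable graphs are word-representable.
\<close>

subsection \<open>Odd wheels\<close>

text \<open>An isomorphism in the library also carries maps for arcs, tails and heads. As arcs are
  ordered pairs here, the vertex map determines all of them, and an injection that preserves and
  reflects arcs suffices.\<close>

lemma contains_induced_iff:
  assumes H: "pair_wf_digraph H"
  shows "contains_induced G H \<longleftrightarrow>
    (\<exists>p. inj_on p (pverts H) \<and> p ` pverts H \<subseteq> pverts G \<and>
      (\<forall>x \<in> pverts H. \<forall>y \<in> pverts H. (p x, p y) \<in> parcs G \<longleftrightarrow> (x, y) \<in> parcs H))"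
    (is "_ \<longleftrightarrow> (\<exists>p. ?embeds p)")
proof
  assume "contains_induced G H"
  then obtain S f where S: "S \<subseteq> pverts G"
    and f: "pre_digraph.digraph_isomorphism (with_proj H) f"
    and eq: "with_proj G \<restriction> S = app_iso f (with_proj H)"
    by (auto simp: contains_induced_def digraph_iso_def)
  define p where "p = iso_verts f"
  have verts: "p ` pverts H = S"
    using arg_cong[OF eq, of verts] by (simp add: p_def)
  have arcs: "{e \<in> parcs G. fst e \<in> S \<and> snd e \<in> S} = iso_arcs f ` parcs H"
    using arg_cong[OF eq, of arcs] by simp
  \<comment> \<open>The equation \<open>eq\<close> also identifies the projections; this forces
    \<open>iso_arcs f\<close> to act on pairs componentwise through \<open>p\<close>.\<close>
  have tail: "iso_tail f = fst" and head: "iso_head f = snd"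
    using arg_cong[OF eq, of tail] arg_cong[OF eq, of head] by simp_all
  have inj: "inj_on p (pverts H)"
    using f by (simp add: pre_digraph.digraph_isomorphism_def p_def)
  have arc: "iso_arcs f (x, y) = (p x, p y)" if "(x, y) \<in> parcs H" for x y
    using f that unfolding pre_digraph.digraph_isomorphism_def tail head
    by (auto simp: p_def prod_eq_iff)
  have "(p x, p y) \<in> parcs G \<longleftrightarrow> (x, y) \<in> parcs H" if xy: "x \<in> pverts H" "y \<in> pverts H" for x y
  proof -
    have "(p x, p y) \<in> parcs G \<longleftrightarrow> (p x, p y) \<in> iso_arcs f ` parcs H"
      using verts xy by (auto simp flip: arcs)
    also have "\<dots> \<longleftrightarrow> (\<exists>a b. (a, b) \<in> parcs H \<and> p a = p x \<and> p b = p y)"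
      using arc by (force simp: image_iff)
    also have "\<dots> \<longleftrightarrow> (x, y) \<in> parcs H"
      using inj xy pair_wf_digraph.in_arcsD1[OF H] pair_wf_digraph.in_arcsD2[OF H]
      by (metis inj_onD)
    finally show ?thesis .
  qed
  then show "\<exists>p. ?embeds p"
    using inj verts S by blast
next
  assume "\<exists>p. ?embeds p"
  then obtain p where inj: "inj_on p (pverts H)" and sub: "p ` pverts H \<subseteq> pverts G"
    and iff: "\<And>x y. x \<in> pverts H \<Longrightarrow> y \<in> pverts H \<Longrightarrow> (p x, p y) \<in> parcs G \<longleftrightarrow> (x, y) \<in> parcs H"
    by blast
  define f where
    "f = \<lparr> iso_verts = p, iso_arcs = map_prod p p, iso_head = snd, iso_tail = fst \<rparr>"
  have inH: "parcs H \<subseteq> pverts H \<times> pverts H"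
    using pair_wf_digraph.in_arcsD1[OF H] pair_wf_digraph.in_arcsD2[OF H] by auto
  have "inj_on (map_prod p p) (parcs H)"
    using map_prod_inj_on[OF inj inj] inH by (rule inj_on_subset)
  then have "pre_digraph.digraph_isomorphism (with_proj H) f"
    using inj H by (simp add: pre_digraph.digraph_isomorphism_def f_def wf_digraph_wp_iff)
  moreover have "{e \<in> parcs G. fst e \<in> p ` pverts H \<and> snd e \<in> p ` pverts H} =
      map_prod p p ` parcs H"
    using inH by (auto simp: iff image_iff) (force simp: iff)+
  then have "with_proj G \<restriction> (p ` pverts H) = app_iso f (with_proj H)"
    by (simp add: induce_subgraph_def app_iso_def f_def)
  ultimately show "contains_induced G H"
    using sub unfolding contains_induced_def digraph_iso_def by blast
qed

section \<open>Alternation expressed by differences of letter counts\<close>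

lemma alternating_word_Suc:
  "alternating_word x y (Suc l) = alternating_word x y l @ [if even l then x else y]"
  by (simp add: alternating_word_def)

lemma length_alternating_word [simp]: "length (alternating_word x y l) = l"
  by (simp add: alternating_word_def)

text \<open>Beyond the length of \<open>w\<close> the value stays constant, so \<open>t\<close> may
  range over all naturals. Leads are additive:
  \<open>lead w x y t = lead w x h t - lead w y h t\<close>.\<close>

definition lead :: "'a list \<Rightarrow> 'a \<Rightarrow> 'a \<Rightarrow> nat \<Rightarrow> int" where
  "lead w x y t = int (count_list (take t w) x) - int (count_list (take t w) y)"

lemma count_list_alternating_word:
  assumes "x \<noteq> y"
  shows "int (count_list (alternating_word x y l) x) - int (count_list (alternating_word x y l) y)
    = (if even l then 0 else 1)"
  using assms by (induction l) (auto simp: alternating_word_Suc alternating_word_def)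

lemma count_list_filter_eq:
  "P x \<Longrightarrow> count_list (filter P w) x = count_list w x"
  by (induction w) auto

text \<open>Reading \<open>xyxy...\<close> from the left, \<open>x\<close> is ahead of
  \<open>y\<close> by one after each \<open>x\<close> and level after each \<open>y\<close>. In the
  induction, appending a letter adds one new prefix, and a violation persists in every
  extension.\<close>

lemma filter_alternating_iff_lead:
  assumes "x \<noteq> y"
  shows "(\<exists>l. filter (\<lambda>z. z \<in> {x, y}) w = alternating_word x y l) \<longleftrightarrow> (\<forall>t. lead w x y t \<in> {0, 1})"
proof (induction w rule: rev_induct)
  case Nil
  then show ?case by (auto simp: lead_def alternating_word_def intro: exI[of _ 0])
next
  case (snoc a w)
  let ?f = "filter (\<lambda>z. z \<in> {x, y})"
  have lead_snoc: "(\<forall>t. lead (w @ [a]) x y t \<in> {0, 1}) \<longleftrightarrow>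
     (\<forall>t. lead w x y t \<in> {0, 1}) \<and> lead (w @ [a]) x y (Suc (length w)) \<in> {0, 1}" (is "?L \<longleftrightarrow> ?R")
  proof
    assume L: ?L
    have "lead w x y t = lead (w @ [a]) x y (min t (length w))" for t
      by (simp add: lead_def min_def)
    with L show ?R by metis
  next
    assume R: ?R
    show ?L
    proof
      fix t
      have "lead (w @ [a]) x y t = lead w x y t" if "t \<le> length w"
        using that by (simp add: lead_def)
      moreover have "lead (w @ [a]) x y t = lead (w @ [a]) x y (Suc (length w))" if "\<not> t \<le> length w"
        using that by (simp add: lead_def)
      ultimately show "lead (w @ [a]) x y t \<in> {0, 1}"
        using R by (cases "t \<le> length w") simp_all
    qed
  qed
  have total: "lead (w @ [a]) x y (Suc (length w)) =
      int (count_list (?f w) x) - int (count_list (?f w) y) + (if a = x then 1 else if a = y then -1 else 0)"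
    using assms by (simp add: lead_def count_list_filter_eq)
  show ?case
  proof (cases "\<exists>l. ?f w = alternating_word x y l")
    case True
    then obtain l where l: "?f w = alternating_word x y l" by blast
    have "(\<exists>k. ?f (w @ [a]) = alternating_word x y k) \<longleftrightarrow>
        a \<notin> {x, y} \<or> a = (if even l then x else y)"
    proof
      assume "\<exists>k. ?f (w @ [a]) = alternating_word x y k"
      then obtain k where k: "?f (w @ [a]) = alternating_word x y k" by blast
      show "a \<notin> {x, y} \<or> a = (if even l then x else y)"
      proof (cases "a \<in> {x, y}")
        case True
        then have "alternating_word x y k = alternating_word x y l @ [a]"
          using k l by simp
        moreover from arg_cong[OF this, of length] have "k = Suc l"
          by simp
        ultimately show ?thesis by (simp add: alternating_word_Suc)
      qed simp
    next
      assume "a \<notin> {x, y} \<or> a = (if even l then x else y)"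
      then have "?f (w @ [a]) = alternating_word x y (if a \<in> {x, y} then Suc l else l)"
        using l by (auto simp: alternating_word_Suc)
      then show "\<exists>k. ?f (w @ [a]) = alternating_word x y k" by (rule exI)
    qed
    moreover have "\<forall>t. lead w x y t \<in> {0, 1}" using snoc True by (rule iffD1)
    ultimately show ?thesis
      unfolding lead_snoc total l using assms by (auto simp: count_list_alternating_word)
  next
    case False
    have "\<nexists>k. ?f (w @ [a]) = alternating_word x y k"
    proof
      assume "\<exists>k. ?f (w @ [a]) = alternating_word x y k"
      then obtain k where k: "?f (w @ [a]) = alternating_word x y k" by blast
      show False
      proof (cases "a \<in> {x, y}")
        case True
        with k obtain k' where k': "k = Suc k'" 
          by (cases k) (auto simp: alternating_word_def)
        with k True have "?f w = alternating_word x y k'"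
          by (simp add: alternating_word_Suc)
        then show ?thesis using False by (rule notE[rotated, OF exI])
      next
        case a: False
        with k have "?f w = alternating_word x y k" by simp
        then show ?thesis using False by (rule notE[rotated, OF exI])
      qed
    qed
    moreover have "\<not> (\<forall>t. lead w x y t \<in> {0, 1})"
      using snoc False by simp
    ultimately show ?thesis unfolding lead_snoc by simp
  qed
qed

lemma lead_swap: "lead w y x t = - lead w x y t"
  by (simp add: lead_def)

text \<open>The free constant \<open>c\<close> covers both possible first letters, and it makes the
  criterion invariant under adding constants to the lead. It can be \<open>0\<close> or
  \<open>-1\<close> only, because the empty prefix has lead \<open>0\<close>.\<close>

lemma alternate_in_iff_lead:
  assumes "x \<noteq> y"
  shows "alternate_in w x y \<longleftrightarrow> (\<exists>c. \<forall>t. lead w x y t \<in> {c, c + 1})"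
proof -
  have "alternate_in w x y \<longleftrightarrow> (\<forall>t. lead w x y t \<in> {0, 1}) \<or> (\<forall>t. lead w x y t \<in> {-1, 0})"
  proof -
    have "alternate_in w x y \<longleftrightarrow> (\<forall>t. lead w x y t \<in> {0, 1}) \<or> (\<forall>t. lead w y x t \<in> {0, 1})"
      using filter_alternating_iff_lead[OF assms, of w] filter_alternating_iff_lead[OF assms[symmetric], of w]
      unfolding alternate_in_def by (auto simp: insert_commute)
    moreover have "lead w y x t \<in> {0, 1} \<longleftrightarrow> lead w x y t \<in> {-1, 0}" for t
      by (auto simp: lead_swap[of w y x])
    ultimately show ?thesis by simp
  qed
  also have "\<dots> \<longleftrightarrow> (\<exists>c. \<forall>t. lead w x y t \<in> {c, c + 1})"
  proof
    assume "\<exists>c. \<forall>t. lead w x y t \<in> {c, c + 1}"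
    then obtain c where c: "\<forall>t. lead w x y t \<in> {c, c + 1}" by blast
    moreover have "lead w x y 0 = 0" by (simp add: lead_def)
    ultimately have "c = 0 \<or> c = -1" by (metis add.commute insert_iff singletonD add_eq_0_iff)
    with c show "(\<forall>t. lead w x y t \<in> {0, 1}) \<or> (\<forall>t. lead w x y t \<in> {-1, 0})" by force
  qed (force intro: exI[of _ 0] exI[of _ "-1"])
  finally show ?thesis .
qed

text \<open>A difference of two indicator functions has values in \<open>{-1, 0, 1}\<close>. It
  stays within two consecutive values iff \<open>1\<close> and \<open>-1\<close> do not both occur,
  that is, iff one of the sets contains the other.\<close>

lemma alternation_on_neighbourhood_is_comparability:
  assumes alt: "\<And>x. x \<in> X \<Longrightarrow> alternate_in w x h" and h: "h \<notin> X"
  obtains S :: "'a \<Rightarrow> nat set"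
  where "\<And>x y. x \<in> X \<Longrightarrow> y \<in> X \<Longrightarrow> x \<noteq> y \<Longrightarrow> alternate_in w x y \<longleftrightarrow> S x \<subseteq> S y \<or> S y \<subseteq> S x"
proof -
  have "\<forall>x. \<exists>c. x \<in> X \<longrightarrow> (\<forall>t. lead w x h t \<in> {c, c + 1})"
    using alt h alternate_in_iff_lead by metis
  then obtain c where c: "\<And>x t. x \<in> X \<Longrightarrow> lead w x h t = c x \<or> lead w x h t = c x + 1"
    by (metis insertE singletonD)
  \<comment> \<open>Up to a constant, \<open>lead w x y\<close> is the difference of the indicator functions of \<open>S x\<close> and \<open>S y\<close>.\<close>
  define S where "S x = {t. lead w x h t = c x + 1}" for x
  have "alternate_in w x y \<longleftrightarrow> S x \<subseteq> S y \<or> S y \<subseteq> S x" if X: "x \<in> X" "y \<in> X" "x \<noteq> y" for x y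
  proof -
    define e where "e t = lead w x h t - c x" for t
    define f where "f t = lead w y h t - c y" for t
    have e: "e t = 0 \<or> e t = 1" "f t = 0 \<or> f t = 1" for t
      using c[of x t] c[of y t] X by (auto simp: e_def f_def)
    have lead: "lead w x y t = c x - c y + (e t - f t)" for t
      by (simp add: lead_def e_def f_def)
    have S: "S x = {t. e t = 1}" "S y = {t. f t = 1}"
      by (auto simp: S_def e_def f_def)
    show ?thesis
    proof
      assume "alternate_in w x y"
      then obtain b where b: "\<And>t. lead w x y t = b \<or> lead w x y t = b + 1"
        using alternate_in_iff_lead[OF X(3)] by (metis insertE singletonD)
      show "S x \<subseteq> S y \<or> S y \<subseteq> S x"
      proof (rule ccontr)
        assume "\<not> ?thesis"
        then obtain s t where "e s = 1" "f s \<noteq> 1" "f t = 1" "e t \<noteq> 1"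
          unfolding S by auto
        with e[of s] e[of t] b[of s] b[of t] show False
          unfolding lead by linarith
      qed
    next
      assume "S x \<subseteq> S y \<or> S y \<subseteq> S x"
      then have "(\<forall>t. e t - f t \<in> {-1, 0}) \<or> (\<forall>t. e t - f t \<in> {0, 1})"
      proof
        assume "S x \<subseteq> S y"
        then have "e t - f t \<in> {-1, 0}" for t using e[of t] unfolding S by auto
        then show ?thesis by blast
      next
        assume "S y \<subseteq> S x"
        then have "e t - f t \<in> {0, 1}" for t using e[of t] unfolding S by auto
        then show ?thesis by blast
      qed
      then have "\<exists>b. \<forall>t. lead w x y t \<in> {b, b + 1}"
      proof
        assume "\<forall>t. e t - f t \<in> {-1, 0}"
        then show ?thesis by (intro exI[of _ "c x - c y - 1"]) (auto simp: lead)
      next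
        assume "\<forall>t. e t - f t \<in> {0, 1}"
        then show ?thesis by (intro exI[of _ "c x - c y"]) (auto simp: lead)
      qed
      then show "alternate_in w x y"
        using alternate_in_iff_lead[OF X(3)] by blast
    qed
  qed
  then show thesis by (rule that)
qed

section \<open>Odd cycles and odd wheels\<close>

lemma wheel_graph_arc_iff:
  "(a, b) \<in> parcs (wheel_graph k) \<longleftrightarrow>
     (a < k \<and> b = (a + 1) mod k) \<or> (b < k \<and> a = (b + 1) mod k) \<or> (a < k \<and> b = k) \<or> (b < k \<and> a = k)"
  by (auto simp: wheel_graph_def doubleton_eq_iff)

text \<open>Two successive inclusions in the same direction would compose to a comparison at
  distance two. So the directions alternate along the cycle, which is impossible after an odd number
  of steps back to the start.\<close>

lemma odd_cycle_not_comparability: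
  fixes S :: "nat \<Rightarrow> 'b set"
  assumes k: "odd k" "5 \<le> k"
    and cyc: "\<And>a. a < k \<Longrightarrow> S a \<subseteq> S ((a + 1) mod k) \<or> S ((a + 1) mod k) \<subseteq> S a"
    and non: "\<And>a. a < k \<Longrightarrow> \<not> (S a \<subseteq> S ((a + 2) mod k) \<or> S ((a + 2) mod k) \<subseteq> S a)"
  shows False
proof -
  define R where "R a = S (a mod k)" for a
  have k0: "k > 0" using k by simp
  have up: "R a \<subseteq> R (Suc a) \<or> R (Suc a) \<subseteq> R a" for a
    using cyc[of "a mod k"] k0 by (simp add: R_def mod_Suc_eq)
  have two: "\<not> (R a \<subseteq> R (Suc (Suc a)) \<or> R (Suc (Suc a)) \<subseteq> R a)" for a
    using non[of "a mod k"] k0 by (simp add: R_def mod_simps)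
  have alt: "R (Suc a) \<subseteq> R (Suc (Suc a)) \<longleftrightarrow> \<not> R a \<subseteq> R (Suc a)" for a
    using up[of a] up[of "Suc a"] two[of a] by blast
  have "R a \<subseteq> R (Suc a) \<longleftrightarrow> (R 0 \<subseteq> R 1 \<longleftrightarrow> even a)" for a
    by (induction a) (auto simp: alt)
  from this[of k] k have "R k \<subseteq> R (Suc k) \<longleftrightarrow> \<not> R 0 \<subseteq> R 1" by simp
  moreover have "R (Suc k) = R 1" "R k = R 0"
    by (simp_all add: R_def mod_Suc_eq flip: mod_Suc_eq[of k])
  ultimately show False by simp
qed

lemma not_word_representable_odd_wheel:
  assumes ind: "contains_induced G (wheel_graph k)" and k: "odd k" "5 \<le> k"
  shows "\<not> word_representable G"
proof
  assume "word_representable G"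
  then obtain w where w: "\<And>x y. x \<in> pverts G \<Longrightarrow> y \<in> pverts G \<Longrightarrow> x \<noteq> y \<Longrightarrow>
      alternate_in w x y \<longleftrightarrow> (x, y) \<in> parcs G"
    unfolding word_representable_def by blast
  have "pair_wf_digraph (wheel_graph k)"
    using pair_graph_wheel_graph[of k] k
    by (auto simp: pair_graph_def pair_digraph_def pair_fin_digraph_def)
  moreover have V: "pverts (wheel_graph k) = {..k}"
    by (simp add: wheel_graph_def)
  ultimately obtain p where inj: "inj_on p {..k}" and sub: "p ` {..k} \<subseteq> pverts G"
    and iff: "\<And>a b. a \<le> k \<Longrightarrow> b \<le> k \<Longrightarrow> (p a, p b) \<in> parcs G \<longleftrightarrow> (a, b) \<in> parcs (wheel_graph k)"
    using ind contains_induced_iff[of "wheel_graph k" G] by auto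
  have alt: "alternate_in w (p a) (p b) \<longleftrightarrow> (a, b) \<in> parcs (wheel_graph k)"
    if "a \<le> k" "b \<le> k" "a \<noteq> b" for a b
    using that w[of "p a" "p b"] iff[of a b] sub inj by (auto simp: inj_on_eq_iff)
  have "alternate_in w x (p k)" if "x \<in> p ` {..<k}" for x
    using that alt by (auto simp: wheel_graph_arc_iff)
  moreover have "p k \<notin> p ` {..<k}"
    using inj by (auto simp: inj_on_eq_iff)
  ultimately obtain S where S: "\<And>x y. x \<in> p ` {..<k} \<Longrightarrow> y \<in> p ` {..<k} \<Longrightarrow> x \<noteq> y \<Longrightarrow>
      alternate_in w x y \<longleftrightarrow> (S x :: nat set) \<subseteq> S y \<or> S y \<subseteq> S x"
    using alternation_on_neighbourhood_is_comparability by metis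
  have rim: "S (p a) \<subseteq> S (p b) \<or> S (p b) \<subseteq> S (p a) \<longleftrightarrow> (a, b) \<in> parcs (wheel_graph k)"
    if "a < k" "b < k" "a \<noteq> b" for a b
    using that S[of "p a" "p b"] alt[of a b] inj by (auto simp: inj_on_eq_iff)
  show False
  proof (rule odd_cycle_not_comparability[OF k, of "S \<circ> p"])
    fix a assume "a < k"
    then show "(S \<circ> p) a \<subseteq> (S \<circ> p) ((a + 1) mod k) \<or> (S \<circ> p) ((a + 1) mod k) \<subseteq> (S \<circ> p) a"
      using rim[of a "(a + 1) mod k"] k mod_Suc_neq[of k a] by (auto simp: wheel_graph_arc_iff)
  next
    \<comment> \<open>Since \<open>k\<close> is at least 5, rim vertices at distance two are
      distinct and non-adjacent.\<close>
    fix a assume a: "a < k"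
    define b where "b = (a + 2) mod k"
    have "b = (if a + 2 < k then a + 2 else a + 2 - k)"
      using a k by (simp add: b_def le_mod_geq)
    then have "b < k" "a \<noteq> b" "b \<noteq> (a + 1) mod k" "a \<noteq> (b + 1) mod k"
      using a k by (auto simp: mod_Suc split: if_splits)
    then show "\<not> ((S \<circ> p) a \<subseteq> (S \<circ> p) ((a + 2) mod k) \<or> (S \<circ> p) ((a + 2) mod k) \<subseteq> (S \<circ> p) a)"
      using rim[of a b] a unfolding wheel_graph_arc_iff b_def[symmetric] by simp
  qed
qed

subsection \<open>Semi-transitive orientations\<close>

text \<open>Every block of the word built below is a filter of a single list sorted by
  \<open>f\<close>, so within a block the ends of an arc appear in the order of the arc.\<close>

lemma filter_pair_sorted:
  assumes L: "distinct L" "sorted (map f L)" and xy: "x \<in> set L" "y \<in> set L" "f x < f y"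
  shows "filter (\<lambda>z. z \<in> {x, y}) (filter P L) =
    (if P x then [x] else []) @ (if P y then [y] else [])"
proof -
  have two: "filter (\<lambda>z. z \<in> {x, y}) L = [x, y]"
  proof -
    let ?F = "filter (\<lambda>z. z \<in> {x, y}) L"
    have F: "set ?F = {x, y}" "distinct ?F" "sorted (map f ?F)"
      using L xy by (auto simp: sorted_filter)
    moreover have "length ?F = 2"
      using distinct_card[OF F(2)] xy(3) unfolding F(1) by (cases "x = y") simp_all
    then obtain p q where "?F = [p, q]"
      by (auto simp: numeral_2_eq_2 length_Suc_conv)
    ultimately have "{p, q} = {x, y}" "f p \<le> f q" by (simp_all del: set_filter)
    with \<open>?F = [p, q]\<close> show ?thesis
      using xy(3) by (auto simp: doubleton_eq_iff)
  qed
  have "filter (\<lambda>z. z \<in> {x, y}) (filter P L) = filter P (filter (\<lambda>z. z \<in> {x, y}) L)"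
    by (simp add: conj_commute)
  then show ?thesis
    unfolding two by simp
qed

lemma filter_pair_single:
  assumes "distinct L" "u \<in> set L" "\<not> P v"
  shows "filter (\<lambda>z. z \<in> {u, v}) (filter P L) = (if P u then [u] else [])"
  using assms by (induction L) (auto simp: filter_empty_conv)

lemma not_alternating_square:
  assumes "x \<noteq> y"
  shows "alternating_word x y l \<noteq> p @ v # v # s"
proof
  assume eq: "alternating_word x y l = p @ v # v # s"
  from arg_cong[OF this, of length] have len: "Suc (length p) < l"
    by simp
  have "alternating_word x y l ! length p = v" "alternating_word x y l ! Suc (length p) = v"
    unfolding eq by (simp_all add: nth_append)
  then show False
    using assms len unfolding alternating_word_def by (simp add: nth_map_upt split: if_splits del: upt_Suc)
qed

text \<open>This is the criterion of Halldorsson, Kitaev and Pyatkin; the relation \<open>r\<close> orients the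
  edges.  The word is a concatenation, over all vertices \<open>v\<close>, of words in which every letter occurs
  twice, every arc \<open>x \<rightarrow> y\<close> reads \<open>xyxy\<close>, and no non-neighbour of \<open>v\<close> alternates with \<open>v\<close>.\<close>

theorem semi_transitive_imp_word_representable:
  fixes f :: "'a \<Rightarrow> nat"
  assumes fin: "finite (pverts G)" and r: "r \<subseteq> pverts G \<times> pverts G"
    and G: "\<And>x y. x \<in> pverts G \<Longrightarrow> y \<in> pverts G \<Longrightarrow> (x, y) \<in> parcs G \<longleftrightarrow> (x, y) \<in> r \<or> (y, x) \<in> r"
    and f: "\<And>x y. (x, y) \<in> r \<Longrightarrow> f x < f y"
    and st: "\<And>x y z. (x, y) \<in> r \<Longrightarrow> (x, z) \<in> r\<^sup>+ \<Longrightarrow> (z, y) \<in> r\<^sup>+ \<Longrightarrow> (x, z) \<in> r \<and> (z, y) \<in> r"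
  shows "word_representable G"
proof -
  obtain L0 where "set L0 = pverts G" "distinct L0"
    using fin finite_distinct_list by blast
  then obtain L where L: "set L = pverts G" "distinct L" "sorted (map f L)"
    using that[of "sort_key f L0"] by simp
  have f_trancl: "f x < f y" if "(x, y) \<in> r\<^sup>+" for x y
    using that by induction (auto dest: f)
  have excl: "\<not> ((x, y) \<in> r\<^sup>+ \<and> (y, x) \<in> r\<^sup>+)" for x y
    using f_trancl[of x y] f_trancl[of y x] by auto
  \<comment> \<open>Relative to \<open>v\<close>, the other vertices split into far ancestors
    \<open>A\<close>, in-neighbours \<open>I\<close>, unrelated vertices \<open>U\<close>,
    out-neighbours \<open>Q\<close> and far descendants \<open>B\<close>.\<close>
  define A where "A v z \<longleftrightarrow> (z, v) \<in> r\<^sup>+ \<and> (z, v) \<notin> r" for v z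
  define I where "I v z \<longleftrightarrow> (z, v) \<in> r" for v z
  define U where "U v z \<longleftrightarrow> z \<noteq> v \<and> (z, v) \<notin> r\<^sup>+ \<and> (v, z) \<notin> r\<^sup>+" for v z
  define Q where "Q v z \<longleftrightarrow> (v, z) \<in> r" for v z
  define B where "B v z \<longleftrightarrow> (v, z) \<in> r\<^sup>+ \<and> (v, z) \<notin> r" for v z
  note defs = A_def I_def U_def Q_def B_def
  \<comment> \<open>Each class occurs twice. Between the two copies of \<open>v\<close> there are
    only neighbours of \<open>v\<close>, so restricting to \<open>v\<close> and a non-neighbour
    leaves the factor \<open>vv\<close>.\<close>
  define W where "W v = filter (A v) L @ filter (I v) L @ filter (U v) L @ filter (A v) L @ [v] @
    filter (Q v) L @ filter (I v) L @ [v] @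
    filter (B v) L @ filter (U v) L @ filter (Q v) L @ filter (B v) L" for v
  have arc: "filter (\<lambda>z. z \<in> {x, y}) (W v) = [x, y, x, y]" if xy: "(x, y) \<in> r" for x y v
  proof -
    have "x \<in> set L" "y \<in> set L" "f x < f y"
      using xy r f L by auto
    note * = filter_pair_sorted[OF L(2,3) this]
    have sub: "(a, b) \<in> r\<^sup>+" if "(a, b) \<in> r" for a b
      using that by auto
    have up: "(x, v) \<in> r\<^sup>+" if "(y, v) \<in> r\<^sup>+"
      using xy that by (rule trancl_into_trancl2)
    have down: "(v, y) \<in> r\<^sup>+" if "(v, x) \<in> r\<^sup>+"
      using that xy by (rule trancl_into_trancl)
    have only: "\<not> A v v" "\<not> I v v" "\<not> U v v" "\<not> Q v v" "\<not> B v v"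
      "\<And>z. A v z \<Longrightarrow> A v z = True \<and> z \<noteq> v \<and> v \<noteq> z \<and> \<not> I v z \<and> \<not> U v z \<and> \<not> Q v z \<and> \<not> B v z"
      "\<And>z. I v z \<Longrightarrow> I v z = True \<and> z \<noteq> v \<and> v \<noteq> z \<and> \<not> A v z \<and> \<not> U v z \<and> \<not> Q v z \<and> \<not> B v z"
      "\<And>z. U v z \<Longrightarrow> U v z = True \<and> z \<noteq> v \<and> v \<noteq> z \<and> \<not> A v z \<and> \<not> I v z \<and> \<not> Q v z \<and> \<not> B v z"
      "\<And>z. Q v z \<Longrightarrow> Q v z = True \<and> z \<noteq> v \<and> v \<noteq> z \<and> \<not> A v z \<and> \<not> I v z \<and> \<not> U v z \<and> \<not> B v z"
      "\<And>z. B v z \<Longrightarrow> B v z = True \<and> z \<noteq> v \<and> v \<noteq> z \<and> \<not> A v z \<and> \<not> I v z \<and> \<not> U v z \<and> \<not> Q v z"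
      unfolding defs using excl sub by blast+
    have from_v: "x = v \<Longrightarrow> Q v y"
      unfolding defs using xy by blast
    \<comment> \<open>The block order spells \<open>xyxy\<close> for all pairs of classes listed
      here. The remaining pairs, such as \<open>A\<close> to \<open>Q\<close>, \<open>I\<close> to
      \<open>A\<close> or \<open>B\<close> to \<open>Q\<close>, are excluded by \<open>st\<close> or
      by transitivity and acyclicity.\<close>
    have from_A: "A v x \<Longrightarrow> A v y \<or> I v y \<or> U v y"
      unfolding defs using xy st[of x y v] excl sub by blast
    have from_I: "I v x \<Longrightarrow> y = v \<or> I v y \<or> U v y \<or> Q v y"
      unfolding defs using xy st[of x y v] st[of x v y] sub by blast
    have from_U: "U v x \<Longrightarrow> U v y \<or> Q v y \<or> B v y"
      unfolding defs using xy up sub by blast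
    have from_Q: "Q v x \<Longrightarrow> Q v y \<or> B v y"
      unfolding defs using down sub by blast
    have from_B: "B v x \<Longrightarrow> B v y"
      unfolding defs using xy down st[of v y x] sub by blast
    have neq: "x \<noteq> y" using f[OF xy] by auto
    consider "x = v" | "A v x" | "I v x" | "U v x" | "Q v x" | "B v x"
      unfolding defs by blast
    then show ?thesis
    proof cases
      case 1
      from only(9)[OF from_v[OF 1]] 1 neq show ?thesis
        unfolding W_def filter_append * by (simp add: only(1-5))
    next
      case 2
      from from_A[OF 2] only(6)[OF 2] neq show ?thesis
        unfolding W_def filter_append * by (elim disjE) (drule only(6-10), simp)+
    next
      case 3
      from from_I[OF 3] have "y = v \<or> y \<noteq> v \<and> (I v y \<or> U v y \<or> Q v y)" using only by blast
      with only(7)[OF 3] neq show ?thesis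
        unfolding W_def filter_append * by (elim disjE conjE) ((drule only(6-10))?, simp add: only(1-5))+
    next
      case 4
      from from_U[OF 4] only(8)[OF 4] neq show ?thesis
        unfolding W_def filter_append * by (elim disjE) (drule only(6-10), simp)+
    next
      case 5
      from from_Q[OF 5] only(9)[OF 5] neq show ?thesis
        unfolding W_def filter_append * by (elim disjE) (drule only(6-10), simp)+
    next
      case 6
      from only(10)[OF from_B[OF 6]] only(10)[OF 6] neq show ?thesis
        unfolding W_def filter_append * by simp
    qed
  qed
  have nonarc: "\<exists>p s. filter (\<lambda>z. z \<in> {u, v}) (W v) = p @ v # v # s"
    if u: "u \<in> pverts G" "u \<noteq> v" "(u, v) \<notin> r" "(v, u) \<notin> r" for u v
  proof -
    have "(v, v) \<notin> r\<^sup>+" "(v, v) \<notin> r"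
      using f_trancl[of v v] by auto
    then have no: "\<not> A v v" "\<not> I v v" "\<not> U v v" "\<not> Q v v" "\<not> B v v"
      by (simp_all add: defs)
    have "u \<in> set L" using u L by simp
    note single = filter_pair_single[OF L(2) this, where v = v]
    note * = single[of "A v", OF no(1)] single[of "I v", OF no(2)] single[of "U v", OF no(3)]
      single[of "Q v", OF no(4)] single[of "B v", OF no(5)]
    have "\<not> I v u" "\<not> Q v u" using u by (simp_all add: defs)
    then show ?thesis
      unfolding W_def filter_append * using u by simp
        (metis append.assoc append_Cons append_Nil)
  qed
  define w where "w = concat (map W L)"
  have set_W: "v \<in> set (W v)" "v \<in> pverts G \<Longrightarrow> set (W v) \<subseteq> pverts G" for v
    using L by (auto simp: W_def)
  have "set w = pverts G"
    using set_W L(1) by (auto simp: w_def)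
  moreover have "alternate_in w x y" if "(x, y) \<in> r" for x y
  proof -
    have "filter (\<lambda>z. z \<in> {x, y}) w = concat (map (\<lambda>v. [x, y, x, y]) L)"
      unfolding w_def filter_concat map_map comp_def arc[OF that] ..
    \<comment> \<open>The blocks have even length, so each of them continues the alternation in
      phase.\<close>
    also have "\<dots> = alternating_word x y (4 * length L)"
    proof (induction L rule: rev_induct)
      case (snoc a L)
      have "4 * length (L @ [a]) = Suc (Suc (Suc (Suc (4 * length L))))" by simp
      then show ?case
        using snoc by (simp only: alternating_word_Suc map_append concat_append) simp
    qed (simp add: alternating_word_def)
    finally show ?thesis unfolding alternate_in_def by blast
  qed
  moreover have "alternate_in w x y \<longleftrightarrow> alternate_in w y x" for x y
    by (auto simp: alternate_in_def insert_commute)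
  moreover have "\<not> alternate_in w u v"
    if uv: "u \<in> pverts G" "v \<in> pverts G" "u \<noteq> v" "(u, v) \<notin> r" "(v, u) \<notin> r" for u v
  proof -
    obtain L1 L2 where "L = L1 @ v # L2"
      using uv(2) L(1) by (metis split_list)
    then obtain p s where "filter (\<lambda>z. z \<in> {u, v}) w = p @ filter (\<lambda>z. z \<in> {u, v}) (W v) @ s"
      by (simp add: w_def)
    with nonarc[OF uv(1,3-5)] obtain p s where "filter (\<lambda>z. z \<in> {u, v}) w = p @ v # v # s"
      by (metis append.assoc append_Cons)
    then show ?thesis
      unfolding alternate_in_def
      using not_alternating_square[OF uv(3)] not_alternating_square[OF uv(3)[symmetric]] by (metis insertE singletonD)
  qed
  ultimately show ?thesis
    unfolding word_representable_def using G by metis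
qed

text \<open>Orienting the edges from smaller to larger colours, a shortcut needs a directed path with
  at least three arcs, so it meets all four colours.\<close>

theorem four_colouring_imp_word_representable:
  fixes c :: "'a \<Rightarrow> nat"
  assumes G: "pair_graph G"
    and c: "\<And>x. x \<in> pverts G \<Longrightarrow> c x < 4"
    and proper: "\<And>x y. (x, y) \<in> parcs G \<Longrightarrow> c x \<noteq> c y"
    and cyc: "\<And>x0 x1 x2 x3. \<lbrakk>(x0, x1) \<in> parcs G; (x1, x2) \<in> parcs G; (x2, x3) \<in> parcs G;
      (x3, x0) \<in> parcs G; c x0 = 0; c x1 = 1; c x2 = 2; c x3 = 3\<rbrakk> \<Longrightarrow> False"
  shows "word_representable G"
proof -
  interpret pair_graph G by (rule G)
  define r where "r = {(x, y) \<in> parcs G. c x < c y}"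
  have c_trancl: "c x < c y" if "(x, y) \<in> r\<^sup>+" for x y
    using that by induction (auto simp: r_def)
  have sym: "(y, x) \<in> parcs G" if "(x, y) \<in> parcs G" for x y
    using that arcs_symmetric by auto
  \<comment> \<open>Four strictly increasing colours below 4 must be 0, 1, 2, 3. The path from
    \<open>a\<close> to \<open>b\<close> is then a single arc, and a 4-cycle forbidden by
    \<open>cyc\<close> arises.\<close>
  have no_shortcut: False
    if "(x, a) \<in> r" "(a, b) \<in> r\<^sup>+" "(b, y) \<in> r" "(x, y) \<in> r" for x a b y
  proof -
    have "c x < c a" "c a < c b" "c b < c y" "c y < 4"
      using that c_trancl[of a b] c[of y] by (auto simp: r_def in_arcsD2)
    then have col: "c x = 0" "c a = 1" "c b = 2" "c y = 3" by auto
    have "(a, b) \<in> r"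
      using that(2)
    proof cases
      case (step z)
      then show ?thesis using c_trancl[of a z] col by (auto simp: r_def)
    qed
    then show False
      using cyc[of x a b y] that col sym by (auto simp: r_def)
  qed
  show ?thesis
  proof (rule semi_transitive_imp_word_representable[where r = r and f = c])
    show "finite (pverts G)" by (rule finite_verts[unfolded with_proj_simps])
    show "r \<subseteq> pverts G \<times> pverts G"
      by (auto simp: r_def in_arcsD1 in_arcsD2)
    show "(x, y) \<in> parcs G \<longleftrightarrow> (x, y) \<in> r \<or> (y, x) \<in> r" for x y
      using proper[of x y] sym[of x y] sym[of y x] by (auto simp: r_def)
    show "c x < c y" if "(x, y) \<in> r" for x y
      using that by (simp add: r_def)
    show "(x, z) \<in> r \<and> (z, y) \<in> r" if xy: "(x, y) \<in> r" and xz: "(x, z) \<in> r\<^sup>+" and zy: "(z, y) \<in> r\<^sup>+" for x y z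
    proof (rule ccontr)
      assume neg: "\<not> ?thesis"
      \<comment> \<open>Take the first arc \<open>x\<close> to \<open>a\<close> and the last arc
        \<open>b\<close> to \<open>y\<close> of the path through \<open>z\<close>. If
        \<open>a\<close> and \<open>b\<close> differ this is a shortcut; if they agree, then
        \<open>z\<close> equals both.\<close>
      obtain a where a: "(x, a) \<in> r" "(a, z) \<in> r\<^sup>*"
        using tranclD[OF xz] by auto
      obtain b where b: "(z, b) \<in> r\<^sup>*" "(b, y) \<in> r"
        using tranclD2[OF zy] by auto
      have "(a, b) \<in> r\<^sup>*" using a b by auto
      moreover have "(a, b) \<notin> r\<^sup>+" using no_shortcut a b xy by blast
      ultimately have "a = b" by (simp add: rtrancl_eq_or_trancl)
      then have "z = a" "z = b"
        using a b c_trancl[of a z] c_trancl[of z a] by (auto simp: rtrancl_eq_or_trancl) 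
      with a b neg show False by auto
    qed
  qed
qed

subsection \<open>Interior degrees\<close>

text \<open>Every edge of the triangulation is listed once, directed to the right or, if it is vertical,
  to the next row; \<open>D i j\<close> says that the diagonal of the cell \<open>(i, j)\<close> is the one through \<open>(i, j)\<close>.\<close>

definition cylinder_arc :: "nat \<Rightarrow> nat \<Rightarrow> (nat \<Rightarrow> nat \<Rightarrow> bool) \<Rightarrow> nat \<times> nat \<Rightarrow> nat \<times> nat \<Rightarrow> bool" where
  "cylinder_arc m n D = (\<lambda>(i, j) (i', j'). j < m \<and> i \<le> n \<and> i' \<le> n \<and>
     (j' = j \<and> i' = i + 1 \<or>
      j' = (j + 1) mod m \<and> (i' = i \<or> i' = i + 1 \<and> D i j \<or> i = i' + 1 \<and> \<not> D i' j)))"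

text \<open>Replaces the set-valued choice of diagonals by the Boolean matrix \<open>D\<close>; the
  later arguments work with \<open>cylinder_arc\<close> alone.\<close>

lemma triangulation_arcs:
  assumes "triangulation m n T"
  obtains D where "pverts T = cylinder_verts m n"
    and "\<And>u v. (u, v) \<in> parcs T \<longleftrightarrow> cylinder_arc m n D u v \<or> cylinder_arc m n D v u"
proof -
  obtain d where d: "\<And>c. c \<in> cells m n \<Longrightarrow> d c \<in> cell_diagonals m c"
    and T: "T = undirected (cylinder_verts m n) (cylinder_edges m n \<union> d ` cells m n)"
    using assms by (auto simp: triangulation_def cylinder_graph_def add_edges_undirected)
  define D where "D i j \<longleftrightarrow> d (i, j) = {(i, j), (i + 1, (j + 1) mod m)}" for i j
  have d_eq: "d (i, j) = (if D i j then {(i, j), (i + 1, (j + 1) mod m)} else {(i + 1, j), (i, (j + 1) mod m)})"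
    if "i < n" "j < m" for i j
  proof -
    have "d (i, j) = {(i, j), (i + 1, (j + 1) mod m)} \<or> d (i, j) = {(i + 1, j), (i, (j + 1) mod m)}"
      using d[of "(i, j)"] that by (simp add: cells_def cell_diagonals_def)
    then show ?thesis unfolding D_def by (cases "D i j") (simp_all only: D_def if_True if_False simp_thms)
  qed
  have edge: "{u, v} \<in> cylinder_edges m n \<longleftrightarrow> (\<exists>i j. j < m \<and>
      (i \<le> n \<and> {u, v} = {(i, j), (i, (j + 1) mod m)} \<or> i < n \<and> {u, v} = {(i, j), (i + 1, j)}))" for u v
    unfolding cylinder_edges_def by blast
  have diag: "{u, v} \<in> d ` cells m n \<longleftrightarrow> (\<exists>i j. j < m \<and> i < n \<and>
      (D i j \<and> {u, v} = {(i, j), (i + 1, (j + 1) mod m)} \<or>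
       \<not> D i j \<and> {u, v} = {(i + 1, j), (i, (j + 1) mod m)}))" for u v
  proof -
    have "{u, v} \<in> d ` cells m n \<longleftrightarrow> (\<exists>i j. i < n \<and> j < m \<and> {u, v} = d (i, j))"
      by (auto simp: cells_def)
    also have "\<dots> \<longleftrightarrow> (\<exists>i j. i < n \<and> j < m \<and>
      {u, v} = (if D i j then {(i, j), (i + 1, (j + 1) mod m)} else {(i + 1, j), (i, (j + 1) mod m)}))"
      using d_eq by (intro ex_cong1 conj_cong refl) simp
    also have "\<dots> \<longleftrightarrow> (\<exists>i j. j < m \<and> i < n \<and>
      (D i j \<and> {u, v} = {(i, j), (i + 1, (j + 1) mod m)} \<or>
       \<not> D i j \<and> {u, v} = {(i + 1, j), (i, (j + 1) mod m)}))"
      by (intro ex_cong1) (simp only: split: if_split, blast)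
    finally show ?thesis .
  qed
  have arcD: "{u, v} \<in> cylinder_edges m n \<union> d ` cells m n" if arc: "cylinder_arc m n D u v" for u v
  proof -
    obtain i j i' j' where uv: "u = (i, j)" "v = (i', j')" by (metis surj_pair)
    have le: "j < m" "i \<le> n" "i' \<le> n"
      using arc unfolding uv cylinder_arc_def by auto
    consider "j' = j" "i' = i + 1" | "j' = (j + 1) mod m" "i' = i"
      | "j' = (j + 1) mod m" "i' = i + 1" "D i j" | "j' = (j + 1) mod m" "i = i' + 1" "\<not> D i' j"
      using arc unfolding uv cylinder_arc_def by auto
    then show ?thesis
    proof cases
      case 1
      with le have "i < n" by simp
      with le 1 show ?thesis unfolding uv cylinder_edges_def by blast
    next
      case 2
      with le show ?thesis unfolding uv cylinder_edges_def by blast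
    next
      case 3
      with le have "(i, j) \<in> cells m n" "{u, v} = d (i, j)"
        by (auto simp: cells_def uv d_eq)
      then show ?thesis by blast
    next
      case 4
      with le have "(i', j) \<in> cells m n" "{u, v} = d (i', j)"
        by (auto simp: cells_def uv d_eq)
      then show ?thesis by blast
    qed
  qed
  have arcI: "cylinder_arc m n D u v \<or> cylinder_arc m n D v u"
    if "{u, v} \<in> cylinder_edges m n \<union> d ` cells m n" for u v
    using that unfolding Un_iff edge diag doubleton_eq_iff
    by (elim disjE exE conjE) (simp_all add: cylinder_arc_def)
  have "(u, v) \<in> parcs T \<longleftrightarrow> cylinder_arc m n D u v \<or> cylinder_arc m n D v u" for u v
    unfolding T parcs_undirected using arcI[of u v] arcD[of u v] arcD[of v u] by (auto simp: insert_commute)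
  then show thesis using that[of D] T by simp
qed

text \<open>Exhibits a wheel by listing its rim in cyclic order. Checking index pairs with
  \<open>a < b\<close> suffices by symmetry, and for a concrete list these are finitely many cases
  for the simplifier.\<close>

lemma contains_wheel_of_list:
  assumes G: "pair_graph G" and k: "3 \<le> k" "length xs = k"
    and dist: "distinct (h # xs)" "set (h # xs) \<subseteq> pverts G"
    and hub: "\<forall>x \<in> set xs. (x, h) \<in> parcs G"
    and rim: "\<forall>b \<in> {..<k}. \<forall>a \<in> {..<b}.
      (xs ! a, xs ! b) \<in> parcs G \<longleftrightarrow> b = a + 1 \<or> a = 0 \<and> b + 1 = k"
  shows "contains_induced G (wheel_graph k)"
proof -
  interpret pair_graph G by (rule G)
  have sym: "(y, x) \<in> parcs G" if "(x, y) \<in> parcs G" for x y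
    using that arcs_symmetric by auto
  have irrefl: "(x, x) \<notin> parcs G" for x
    using no_loops' by blast
  define p where "p = (!) (xs @ [h])"
  have p: "p a = (if a < k then xs ! a else h)" if "a \<le> k" for a
    using that k by (simp add: p_def nth_append)
  have set: "set (xs @ [h]) = p ` {..k}" 
    using k by (auto simp: p_def set_conv_nth less_Suc_eq_le simp del: set_append) 
  have wheel_arc: "(a, b) \<in> parcs (wheel_graph k) \<longleftrightarrow>
      (if b < k then b = a + 1 \<or> a = 0 \<and> b + 1 = k else True)" if "a < b" "b \<le> k" for a b
    using that k by (auto simp: wheel_graph_arc_iff mod_Suc split: if_splits)
  have wheel_sym: "(a, b) \<in> parcs (wheel_graph k) \<longleftrightarrow> (b, a) \<in> parcs (wheel_graph k)" for a b
    by (auto simp: wheel_graph_arc_iff)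
  have up: "(p a, p b) \<in> parcs G \<longleftrightarrow> (a, b) \<in> parcs (wheel_graph k)" if "a < b" "b \<le> k" for a b
    using that hub rim k by (auto simp: p wheel_arc)
  have "(p a, p b) \<in> parcs G \<longleftrightarrow> (a, b) \<in> parcs (wheel_graph k)" if ab: "a \<le> k" "b \<le> k" for a b
  proof (cases a b rule: linorder_cases)
    case less
    then show ?thesis using up ab by blast
  next
    case equal
    have "(a, a) \<notin> parcs (wheel_graph k)"
      using k ab mod_Suc_neq[of k a] by (auto simp: wheel_graph_arc_iff)
    with equal show ?thesis using irrefl by simp
  next
    case greater
    then show ?thesis
      using up[of b a] ab sym[of "p a" "p b"] sym[of "p b" "p a"] wheel_sym[of a b] by blast
  qed
  moreover have "inj_on p {..k}"
    using dist k inj_on_nth[of "xs @ [h]" "{..k}"] by (auto simp: p_def)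
  moreover have "p ` {..k} \<subseteq> pverts G"
    using dist unfolding set[symmetric] by simp
  moreover have "pair_wf_digraph (wheel_graph k)" "pverts (wheel_graph k) = {..k}"
    using pair_graph_wheel_graph[OF k(1)]
    by (auto simp: pair_graph_def pair_digraph_def pair_fin_digraph_def wheel_graph_def)
  ultimately show ?thesis
    unfolding contains_induced_iff[OF \<open>pair_wf_digraph (wheel_graph k)\<close>] by auto
qed

text \<open>The vertex in row \<open>Suc i\<close> and column \<open>(l + 1) mod m\<close> has four
  grid neighbours and one more for each diagonal at it in the four surrounding cells. If the parity
  condition fails, one or three diagonals meet it, and its link is an induced 5-cycle or
  7-cycle.\<close>

lemma parity_of_interior_vertex:
  assumes m: "4 \<le> m" and G: "pair_graph T" and T: "pverts T = cylinder_verts m n"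
    and arc: "\<And>u v. (u, v) \<in> parcs T \<longleftrightarrow> cylinder_arc m n D u v \<or> cylinder_arc m n D v u"
    and i: "Suc i < n" and l: "l < m" 
    and no: "\<not> contains_induced T (wheel_graph 5)" "\<not> contains_induced T (wheel_graph 7)"
  shows "(D i l \<longleftrightarrow> D i ((l + 1) mod m)) \<longleftrightarrow> (D (Suc i) l \<longleftrightarrow> D (Suc i) ((l + 1) mod m))"
proof (rule ccontr)
  assume odd: "\<not> ?thesis"
  \<comment> \<open>The hub lies in column \<open>c\<close>, between \<open>l\<close> and
    \<open>r\<close>. As \<open>m\<close> is at least 4, columns \<open>l\<close> and
    \<open>r\<close> are not adjacent, so the link has no chord around the back of the
    cylinder.\<close>
  define c where "c = (l + 1) mod m"
  define r where "r = (c + 1) mod m"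
  have lt: "c < m" "r < m" using m by (auto simp: c_def r_def)
  have ne: "l \<noteq> c" "c \<noteq> l" "c \<noteq> r" "r \<noteq> c" "l \<noteq> r" "r \<noteq> l"
    using l m by (auto simp: c_def r_def mod_Suc split: if_splits)
  have nx: "Suc l mod m = c" "Suc c mod m = r" "Suc r mod m \<noteq> l" "Suc r mod m \<noteq> c" "Suc r mod m \<noteq> r"
      "l \<noteq> Suc r mod m" "c \<noteq> Suc r mod m" "r \<noteq> Suc r mod m"
    using l m by (auto simp: c_def r_def mod_Suc split: if_splits)
  have adj:
    "((a, c), (b, c)) \<in> parcs T \<longleftrightarrow> a \<le> n \<and> b \<le> n \<and> (b = Suc a \<or> a = Suc b)"
    "((a, l), (b, l)) \<in> parcs T \<longleftrightarrow> a \<le> n \<and> b \<le> n \<and> (b = Suc a \<or> a = Suc b)"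
    "((a, r), (b, r)) \<in> parcs T \<longleftrightarrow> a \<le> n \<and> b \<le> n \<and> (b = Suc a \<or> a = Suc b)"
    "((a, l), (b, c)) \<in> parcs T \<longleftrightarrow> a \<le> n \<and> b \<le> n \<and> (b = a \<or> b = Suc a \<and> D a l \<or> a = Suc b \<and> \<not> D b l)"
    "((b, c), (a, l)) \<in> parcs T \<longleftrightarrow> a \<le> n \<and> b \<le> n \<and> (b = a \<or> b = Suc a \<and> D a l \<or> a = Suc b \<and> \<not> D b l)"
    "((a, c), (b, r)) \<in> parcs T \<longleftrightarrow> a \<le> n \<and> b \<le> n \<and> (b = a \<or> b = Suc a \<and> D a c \<or> a = Suc b \<and> \<not> D b c)"
    "((b, r), (a, c)) \<in> parcs T \<longleftrightarrow> a \<le> n \<and> b \<le> n \<and> (b = a \<or> b = Suc a \<and> D a c \<or> a = Suc b \<and> \<not> D b c)"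
    "((a, l), (b, r)) \<notin> parcs T" "((b, r), (a, l)) \<notin> parcs T" for a b
    unfolding arc cylinder_arc_def using l lt ne nx by auto
  have verts: "(a, l) \<in> pverts T \<longleftrightarrow> a \<le> n" "(a, c) \<in> pverts T \<longleftrightarrow> a \<le> n" "(a, r) \<in> pverts T \<longleftrightarrow> a \<le> n" for a
    unfolding T cylinder_verts_def using l lt by auto
  have i': "i \<le> n" "Suc i \<le> n" "Suc (Suc i) \<le> n" using i by auto
  note facts = adj verts ne i' lessThan_nat_numeral lessThan_Suc
  let ?N = "(i, c)" and ?S = "(Suc (Suc i), c)" and ?E = "(Suc i, r)" and ?W = "(Suc i, l)"
  let ?NE = "(i, r)" and ?SE = "(Suc (Suc i), r)" and ?NW = "(i, l)" and ?SW = "(Suc (Suc i), l)"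
  note wheel = contains_wheel_of_list[OF G, where h = "(Suc i, c)"]
  consider
      "D i l" "D i c" "D (Suc i) l" "\<not> D (Suc i) c" | "D i l" "D i c" "\<not> D (Suc i) l" "D (Suc i) c"
    | "D i l" "\<not> D i c" "D (Suc i) l" "D (Suc i) c" | "\<not> D i l" "D i c" "D (Suc i) l" "D (Suc i) c"
    | "\<not> D i l" "\<not> D i c" "\<not> D (Suc i) l" "D (Suc i) c" | "\<not> D i l" "\<not> D i c" "D (Suc i) l" "\<not> D (Suc i) c"
    | "\<not> D i l" "D i c" "\<not> D (Suc i) l" "\<not> D (Suc i) c" | "D i l" "\<not> D i c" "\<not> D (Suc i) l" "\<not> D (Suc i) c"
    using odd unfolding c_def by blast
  then have "contains_induced T (wheel_graph 5) \<or> contains_induced T (wheel_graph 7)"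
  proof cases
    case 1
    then have "contains_induced T (wheel_graph 5)"
      by (intro wheel[where xs = "[?N, ?E, ?S, ?W, ?NW]"]) (simp_all add: facts)
    then show ?thesis ..
  next
    case 2
    then have "contains_induced T (wheel_graph 7)"
      by (intro wheel[where xs = "[?N, ?E, ?SE, ?S, ?SW, ?W, ?NW]"]) (simp_all add: facts)
    then show ?thesis ..
  next
    case 3
    then have "contains_induced T (wheel_graph 7)"
      by (intro wheel[where xs = "[?N, ?NE, ?E, ?SE, ?S, ?W, ?NW]"]) (simp_all add: facts)
    then show ?thesis ..
  next
    case 4
    then have "contains_induced T (wheel_graph 5)"
      by (intro wheel[where xs = "[?N, ?E, ?SE, ?S, ?W]"]) (simp_all add: facts)
    then show ?thesis ..
  next
    case 5
    then have "contains_induced T (wheel_graph 7)"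
      by (intro wheel[where xs = "[?N, ?NE, ?E, ?SE, ?S, ?SW, ?W]"]) (simp_all add: facts)
    then show ?thesis ..
  next
    case 6
    then have "contains_induced T (wheel_graph 5)"
      by (intro wheel[where xs = "[?N, ?NE, ?E, ?S, ?W]"]) (simp_all add: facts)
    then show ?thesis ..
  next
    case 7
    then have "contains_induced T (wheel_graph 5)"
      by (intro wheel[where xs = "[?N, ?E, ?S, ?SW, ?W]"]) (simp_all add: facts)
    then show ?thesis ..
  next
    case 8
    then have "contains_induced T (wheel_graph 7)"
      by (intro wheel[where xs = "[?N, ?NE, ?E, ?S, ?SW, ?W, ?NW]"]) (simp_all add: facts)
    then show ?thesis ..
  qed
  with no show False by blast
qed

subsection \<open>The four-colouring\<close>

text \<open>Consecutive crossings of column gaps cannot reverse direction, as each gap is one-way; hence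
  a closed walk that crosses a gap goes around the whole cylinder.\<close>

lemma one_way_four_walk_not_closed:
  fixes x :: "nat \<Rightarrow> int" and j :: "nat \<Rightarrow> nat" and R S :: "nat \<Rightarrow> bool"
  assumes m: "4 \<le> m" and S: "5 \<le> m \<or> (\<forall>g. S g)"
    and j: "\<And>k. j k < m"
    and steps: "\<And>k. k < 4 \<Longrightarrow> j (Suc k) = j k \<and> x (Suc k) = x k + 1 \<or>
      j (Suc k) = (j k + 1) mod m \<and> R (j k) \<and> x (Suc k) = x k - (if S (j k) then 1 else 0) \<or>
      j k = (j (Suc k) + 1) mod m \<and> \<not> R (j (Suc k)) \<and>
        x (Suc k) = x k - (if S (j (Suc k)) then 1 else 0)"
    and closed: "j 4 = j 0" "x 4 = x 0"
  shows False
proof -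
  have inj: "a = b" if "(a + 1) mod m = (b + 1) mod m" "a < m" "b < m" for a b
    using that m by (auto simp: mod_Suc split: if_splits)
  have turn: False if "(a + 1) mod m = (b + 1) mod m" "a < m" "b < m" "R a" "\<not> R b" for a b
    using inj[OF that(1-3)] that by simp
  \<comment> \<open>Invariant: no gap has been crossed yet, or \<open>a\<close> gaps have been
    crossed, all to the right or all to the left. It remembers the last gap crossed, since turning
    back would use that gap in the wrong direction. If \<open>S\<close> holds everywhere, a crossing
    changes \<open>x\<close> by \<open>-1\<close> instead of \<open>+1\<close>, whence the term
    \<open>2 * int a\<close>.\<close>
  have walk: "j k = j 0 \<and> x k = x 0 + int k \<or>
     (\<exists>a. 1 \<le> a \<and> a \<le> k \<and> j k = (j 0 + a) mod m \<and> (\<exists>g<m. j k = (g + 1) mod m \<and> R g) \<and>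
       ((\<forall>g. S g) \<longrightarrow> x k = x 0 + int k - 2 * int a)) \<or>
     (\<exists>a. 1 \<le> a \<and> a \<le> k \<and> j 0 = (j k + a) mod m \<and> \<not> R (j k) \<and>
       ((\<forall>g. S g) \<longrightarrow> x k = x 0 + int k - 2 * int a))" (is "?still k \<or> ?right k \<or> ?left k")
    if "k \<le> 4" for k
    using that
  proof (induction k)
    case (Suc k)
    then have "?still k \<or> ?right k \<or> ?left k" by simp
    moreover have k: "k < 4" using Suc.prems by simp
    have "?still (Suc k) \<or> ?right (Suc k) \<or> ?left (Suc k)" if "?still k"
      using steps[OF k]
    proof (elim disjE)
      assume "j (Suc k) = j k \<and> x (Suc k) = x k + 1"
      with \<open>?still k\<close> show ?thesis by simp
    next
      assume "j (Suc k) = (j k + 1) mod m \<and> R (j k) \<and> x (Suc k) = x k - (if S (j k) then 1 else 0)"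
      moreover from this j[of k] have "\<exists>g<m. j (Suc k) = (g + 1) mod m \<and> R g" by blast
      ultimately have "?right (Suc k)"
        using \<open>?still k\<close> by (intro exI[of _ 1]) auto
      then show ?thesis by blast
    next
      assume "j k = (j (Suc k) + 1) mod m \<and> \<not> R (j (Suc k)) \<and>
        x (Suc k) = x k - (if S (j (Suc k)) then 1 else 0)"
      with \<open>?still k\<close> have "?left (Suc k)"
        by (intro exI[of _ 1] conjI) auto
      then show ?thesis by blast
    qed
    moreover have "?right (Suc k)" if "?right k"
    proof -
      obtain a g where a: "1 \<le> a" "a \<le> k" "j k = (j 0 + a) mod m" "g < m" "j k = (g + 1) mod m" "R g"
        "(\<forall>g. S g) \<longrightarrow> x k = x 0 + int k - 2 * int a"
        using \<open>?right k\<close> by blast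
      show ?thesis
        using steps[OF k]
      proof (elim disjE)
        assume "j (Suc k) = j k \<and> x (Suc k) = x k + 1"
        with a show ?thesis by (intro exI[of _ a]) auto
      next
        assume *: "j (Suc k) = (j k + 1) mod m \<and> R (j k) \<and> x (Suc k) = x k - (if S (j k) then 1 else 0)"
        have "(j k + 1) mod m = (j 0 + Suc a) mod m"
          unfolding a(3) by (simp add: mod_Suc_eq)
        moreover have "\<exists>g<m. j (Suc k) = (g + 1) mod m \<and> R g" using * j[of k] by blast
        ultimately show ?thesis using a * by (intro exI[of _ "Suc a"]) auto
      next
        assume "j k = (j (Suc k) + 1) mod m \<and> \<not> R (j (Suc k)) \<and>
          x (Suc k) = x k - (if S (j (Suc k)) then 1 else 0)"
        with a j[of "Suc k"] turn[of g "j (Suc k)"] show ?thesis by simp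
      qed
    qed
    moreover have "?left (Suc k)" if "?left k"
    proof -
      obtain a where a: "1 \<le> a" "a \<le> k" "j 0 = (j k + a) mod m" "\<not> R (j k)"
        "(\<forall>g. S g) \<longrightarrow> x k = x 0 + int k - 2 * int a"
        using \<open>?left k\<close> by blast
      show ?thesis
        using steps[OF k]
      proof (elim disjE)
        assume "j (Suc k) = j k \<and> x (Suc k) = x k + 1"
        with a show ?thesis by (intro exI[of _ a]) auto
      next
        assume "j (Suc k) = (j k + 1) mod m \<and> R (j k) \<and> x (Suc k) = x k - (if S (j k) then 1 else 0)"
        with a show ?thesis by simp
      next
        assume *: "j k = (j (Suc k) + 1) mod m \<and> \<not> R (j (Suc k)) \<and>
          x (Suc k) = x k - (if S (j (Suc k)) then 1 else 0)"
        then have "(j k + a) mod m = (j (Suc k) + Suc a) mod m"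
          by (simp add: mod_add_left_eq)
        with a * show ?thesis by (intro exI[of _ "Suc a"]) auto
      qed
    qed
    ultimately show ?case by blast
  qed simp
  from walk[of 4] closed obtain a where a: "1 \<le> a" "a \<le> 4" "j 0 = (j 0 + a) mod m"
    "(\<forall>g. S g) \<longrightarrow> x 0 = x 0 + 4 - 2 * int a"
    by auto
  \<comment> \<open>A closed walk with at most four crossings goes around exactly once, so
    \<open>m\<close> is 4. Then \<open>S\<close> holds everywhere and \<open>x\<close> drops by 4,
    contrary to closedness.\<close>
  have "a = m"
    using a(1-3) j[of 0] m by (cases "j 0 + a < m") (auto simp: le_mod_geq split: if_splits)
  with a m S show False by auto
qed

section \<open>Row and column signs, and the colouring modulo 4\<close>

text \<open>Read as a matrix of signs, \<open>D\<close> has product 1 on all adjacent 2-by-2 blocks,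
  so it has rank one. Its first column and first row serve as the factors.\<close>

lemma separable_of_parity:
  fixes D :: "nat \<Rightarrow> nat \<Rightarrow> bool"
  assumes par: "\<And>i j. Suc i < n \<Longrightarrow> Suc j < m \<Longrightarrow>
      (D i j \<longleftrightarrow> D i (Suc j)) \<longleftrightarrow> (D (Suc i) j \<longleftrightarrow> D (Suc i) (Suc j))"
  obtains v h where "\<And>i j. i < n \<Longrightarrow> j < m \<Longrightarrow> D i j \<longleftrightarrow> (v i \<longleftrightarrow> h j)"
proof -
  have row: "(D i j \<longleftrightarrow> D i 0) \<longleftrightarrow> (D (Suc i) j \<longleftrightarrow> D (Suc i) 0)" if "Suc i < n" "j < m" for i j
    using that(2)
  proof (induction j)
    case (Suc j)
    then show ?case using par[OF that(1), of j] by auto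
  qed simp
  have "(D i j \<longleftrightarrow> D i 0) \<longleftrightarrow> (D 0 j \<longleftrightarrow> D 0 0)" if "i < n" "j < m" for i j
    using that(1)
  proof (induction i)
    case (Suc i)
    then show ?case using row[of i j] that(2) by auto
  qed simp
  then have "D i j \<longleftrightarrow> ((D i 0 \<longleftrightarrow> D 0 0) \<longleftrightarrow> D 0 j)" if "i < n" "j < m" for i j
    using that by blast
  then show thesis by (rule that)
qed

text \<open>For even \<open>m\<close> the increment 2 in every column works. For odd
  \<open>m\<close>, keep a common sign \<open>s\<close> in two columns: the total
  \<open>2 * (m + s - 2)\<close> is divisible by 4 because \<open>m + s\<close> is even.\<close>

lemma column_increments:
  fixes h :: "nat \<Rightarrow> bool"
  assumes m: "4 \<le> m"
  obtains S :: "nat \<Rightarrow> bool" where "5 \<le> m \<or> (\<forall>j. S j)"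
    "(\<Sum>j<m. if S j then 2 else if h j then 1 else (-1::int)) mod 4 = 0"
proof (cases "even m")
  case True
  then have "(\<Sum>j<m. (2::int)) mod 4 = 0" by (auto elim!: evenE)
  then show thesis by (intro that[of "\<lambda>_. True"]) simp_all
next
  case False
  \<comment> \<open>Pigeonhole: two of any three signs agree.\<close>
  have "h 0 = h 1 \<or> h 0 = h 2 \<or> h 1 = h 2" by blast
  then obtain a b where ab: "a < b" "b < m" "h a = h b"
    using m by (elim disjE) (auto intro: that[of 0 1] that[of 0 2] that[of 1 2])
  define S where "S j \<longleftrightarrow> j \<noteq> a \<and> j \<noteq> b" for j
  define s where "s = (if h a then 1 else (-1::int))"
  have "(\<Sum>j<m. if S j then 2 else if h j then 1 else (-1::int)) =
      (\<Sum>j<m. 2 + (if j = a then s - 2 else 0) + (if j = b then s - 2 else 0))"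
    using ab by (intro sum.cong) (auto simp: S_def s_def)
  also have "\<dots> = 2 * int m + 2 * (s - 2)"
    using ab by (simp add: sum.distrib)
  finally have sum: "(\<Sum>j<m. if S j then 2 else if h j then 1 else (-1::int)) = 2 * int m + 2 * (s - 2)" .
  obtain q where "m = 2 * q + 1" using False by (elim oddE)
  then have "(2 * int m + 2 * (s - 2)) mod 4 = 0"
    by (simp add: s_def)
  moreover have "5 \<le> m" using False m by (cases "m = 4") auto
  ultimately show thesis using sum by (intro that[of S]) simp_all
qed

text \<open>Along every edge the integer \<open>X i + \<Sum>a<j. \<plusminus>1\<close> with signs \<open>h a\<close> changes by \<open>\<plusminus>1\<close> or \<open>\<plusminus>2\<close>, but it
  need not close up around the cylinder.  Replacing some of the column steps by \<open>2\<close> keeps the colouring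
  modulo 4 proper and makes it close up.\<close>

lemma separable_triangulation_word_representable:
  assumes m: "4 \<le> m" and G: "pair_graph T" and T: "pverts T = cylinder_verts m n"
    and arc: "\<And>u v. (u, v) \<in> parcs T \<longleftrightarrow> cylinder_arc m n D u v \<or> cylinder_arc m n D v u"
    and D: "\<And>i j. i < n \<Longrightarrow> j < m \<Longrightarrow> D i j \<longleftrightarrow> (v i \<longleftrightarrow> h j)"
  shows "word_representable T"
proof -
  obtain S where S: "5 \<le> m \<or> (\<forall>j. S j)"
    and sum: "(\<Sum>j<m. if S j then 2 else if h j then 1 else (-1::int)) mod 4 = 0"
    using column_increments[OF m] by metis
  define \<delta> where "\<delta> j = (if S j then 2 else if h j then 1 else (-1::int))" for j
  define X where "X i = (\<Sum>a<i. if v a then 1 else (-1::int))" for i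
  define K where "K j = (\<Sum>a<j. \<delta> a)" for j
  define f where "f = (\<lambda>(i, j). X i + K j)"
  have X_Suc: "X (Suc i) = X i + (if v i then 1 else -1)" for i
    by (simp add: X_def)
  have K_next: "K ((j + 1) mod m) mod 4 = (K j + \<delta> j) mod 4" if "j < m" for j
  proof (cases "Suc j = m")
    case True
    then have "K j + \<delta> j = K m" by (auto simp: K_def)
    moreover have "K m mod 4 = 0" using sum by (simp add: K_def \<delta>_def)
    ultimately show ?thesis using True by (simp add: K_def)
  qed (use that in \<open>simp add: K_def\<close>)
  \<comment> \<open>Separability enters here: traversed to the right, either kind of diagonal in gap
    \<open>j\<close> changes \<open>X\<close> by the sign of \<open>h j\<close>.\<close>
  have fwd: "j' = j \<and> (X i' - X i = 1 \<or> X i' - X i = -1) \<or>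
      j' = (j + 1) mod m \<and> (X i' = X i \<or> X i' - X i = (if h j then 1 else -1))"
    and lt: "j < m" "j' < m"
    if "cylinder_arc m n D (i, j) (i', j')" for i j i' j'
  proof -
    show "j < m" "j' < m" using that m by (auto simp: cylinder_arc_def)
    show "j' = j \<and> (X i' - X i = 1 \<or> X i' - X i = -1) \<or>
      j' = (j + 1) mod m \<and> (X i' = X i \<or> X i' - X i = (if h j then 1 else -1))"
      using that D[of i j] D[of i' j] X_Suc[of i] X_Suc[of i']
      by (auto simp: cylinder_arc_def split: if_splits)
  qed
  have shift: "(b mod 4 = a mod 4 \<longleftrightarrow> 4 dvd c) \<and> (b mod 4 = (a + 1) mod 4 \<longleftrightarrow> 4 dvd c - 1) \<and>
      (a mod 4 = (b + 1) mod 4 \<longleftrightarrow> 4 dvd c + 1)" if "b mod 4 = (a + c) mod 4" for a b c :: int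
  proof -
    have "4 dvd b - (a + c)"
      using that by (simp only: mod_eq_dvd_iff)
    then obtain q where "b - (a + c) = 4 * q" by (elim dvdE)
    then have b: "b = a + c + 4 * q" by simp
    have "4 dvd b - a \<longleftrightarrow> 4 dvd c" unfolding b by presburger
    moreover have "4 dvd b - (a + 1) \<longleftrightarrow> 4 dvd c - 1" unfolding b by presburger
    moreover have "4 dvd a - (b + 1) \<longleftrightarrow> 4 dvd c + 1" unfolding b by presburger
    ultimately show ?thesis unfolding mod_eq_dvd_iff by blast
  qed
  \<comment> \<open>To the right across gap \<open>j\<close>, the colour changes by \<open>2\<close>
    or \<open>2 + s\<close> if \<open>S j\<close>, and by \<open>s\<close> or \<open>2 * s\<close>
    otherwise, where \<open>s\<close> is the sign of \<open>h j\<close>. None of these is 0 modulo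
    4. For each gap exactly one is odd, so steps raising the colour by 1 cross it in one direction
    only, to the right iff \<open>h j\<close> differs from \<open>S j\<close>.\<close>
  have residues: "f (i', j') mod 4 \<noteq> f (i, j) mod 4 \<and>
      (f (i', j') mod 4 = (f (i, j) + 1) mod 4 \<longrightarrow> j' = j \<and> X i' = X i + 1 \<or>
        j' = (j + 1) mod m \<and> h j \<noteq> S j \<and> X i' = X i - (if S j then 1 else 0)) \<and>
      (f (i, j) mod 4 = (f (i', j') + 1) mod 4 \<longrightarrow> j' = j \<and> X i = X i' + 1 \<or>
        j' = (j + 1) mod m \<and> \<not> h j \<noteq> S j \<and> X i = X i' - (if S j then 1 else 0))"
    if arc: "cylinder_arc m n D (i, j) (i', j')" for i j i' j'
    using fwd[OF arc]
  proof (elim disjE conjE)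
    assume "j' = j" "X i' - X i = 1"
    then have "f (i', j') = f (i, j) + 1" by (simp add: f_def)
    then show ?thesis
      using shift[of "f (i', j')" "f (i, j)" 1] \<open>j' = j\<close> \<open>X i' - X i = 1\<close> by simp
  next
    assume "j' = j" "X i' - X i = -1"
    then have "f (i', j') = f (i, j) + (-1)" by (simp add: f_def)
    then show ?thesis
      using shift[of "f (i', j')" "f (i, j)" "-1"] \<open>j' = j\<close> \<open>X i' - X i = -1\<close> by simp
  next
    assume j': "j' = (j + 1) mod m" and X: "X i' = X i"
    have "f (i', j') mod 4 = (f (i, j) + \<delta> j) mod 4"
      using K_next[OF lt(1)[OF arc]] X unfolding f_def j' prod.case
      by (metis add.assoc mod_add_right_eq)
    from shift[OF this] show ?thesis
      using j' X unfolding \<delta>_def by (cases "S j"; cases "h j") simp_all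
  next
    assume j': "j' = (j + 1) mod m" and X: "X i' - X i = (if h j then 1 else -1)"
    have "f (i', j') mod 4 = (f (i, j) + (\<delta> j + (if h j then 1 else -1))) mod 4"
    proof -
      have "f (i', j') = X i + (if h j then 1 else -1) + K j'"
        using X by (simp add: f_def)
      also have "\<dots> mod 4 = (X i + (if h j then 1 else -1) + (K j + \<delta> j)) mod 4"
        using K_next[OF lt(1)[OF arc]] unfolding j' by (metis mod_add_right_eq)
      finally show ?thesis by (simp add: f_def algebra_simps)
    qed
    from shift[OF this] show ?thesis
      using j' X unfolding \<delta>_def by (cases "S j"; cases "h j") simp_all
  qed
  have step: "j' = j \<and> X i' = X i + 1 \<or>
      j' = (j + 1) mod m \<and> h j \<noteq> S j \<and> X i' = X i - (if S j then 1 else 0) \<or>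
      j = (j' + 1) mod m \<and> \<not> h j' \<noteq> S j' \<and> X i' = X i - (if S j' then 1 else 0)"
    if "((i, j), (i', j')) \<in> parcs T" "f (i', j') mod 4 = (f (i, j) + 1) mod 4" for i j i' j'
    using that(1) unfolding arc
  proof
    assume "cylinder_arc m n D (i, j) (i', j')"
    from residues[OF this] that(2) show ?thesis by blast
  next
    assume "cylinder_arc m n D (i', j') (i, j)"
    from residues[OF this] that(2) have "j = j' \<and> X i' = X i + 1 \<or>
        j = (j' + 1) mod m \<and> \<not> h j' \<noteq> S j' \<and> X i' = X i - (if S j' then 1 else 0)"
      by blast
    then show ?thesis by blast
  qed
  show ?thesis
  proof (rule four_colouring_imp_word_representable[OF G, of "\<lambda>u. nat (f u mod 4)"])
    show "nat (f u mod 4) < 4" for u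
      using pos_mod_bound[of 4 "f u"] by linarith
    show "nat (f u mod 4) \<noteq> nat (f w mod 4)" if "(u, w) \<in> parcs T" for u w
    proof -
      obtain i j i' j' where uw: "u = (i, j)" "w = (i', j')" by (metis surj_pair)
      have "f u mod 4 \<noteq> f w mod 4"
        using that residues[of i j i' j'] residues[of i' j' i j] unfolding uw arc by metis
      then show ?thesis by (simp add: nat_eq_iff2)
    qed
    fix u0 u1 u2 u3
    assume cyc: "(u0, u1) \<in> parcs T" "(u1, u2) \<in> parcs T" "(u2, u3) \<in> parcs T" "(u3, u0) \<in> parcs T"
      and col: "nat (f u0 mod 4) = 0" "nat (f u1 mod 4) = 1" "nat (f u2 mod 4) = 2" "nat (f u3 mod 4) = 3"
    \<comment> \<open>Indexing modulo 4 closes the walk; the step from colour 3 back to 0 also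
      raises the colour by 1 modulo 4.\<close>
    define U where "U k = [u0, u1, u2, u3] ! (k mod 4)" for k
    have "f u0 mod 4 = 0" "f u1 mod 4 = 1" "f u2 mod 4 = 2" "f u3 mod 4 = 3"
      using col pos_mod_sign[of 4 "f u0"] by (auto simp: nat_eq_iff)
    then have f_step: "f u1 mod 4 = (f u0 + 1) mod 4" "f u2 mod 4 = (f u1 + 1) mod 4"
      "f u3 mod 4 = (f u2 + 1) mod 4" "f u0 mod 4 = (f u3 + 1) mod 4"
      by presburger+
    have U_eqs: "U 0 = u0" "U 1 = u1" "U 2 = u2" "U 3 = u3"
      "U (Suc 0) = u1" "U (Suc 1) = u2" "U (Suc 2) = u3" "U (Suc 3) = u0"
      by (simp_all add: U_def)
    have U: "(U k, U (Suc k)) \<in> parcs T \<and> f (U (Suc k)) mod 4 = (f (U k) + 1) mod 4" if "k < 4" for k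
    proof -
      from that have "k = 0 \<or> k = 1 \<or> k = 2 \<or> k = 3" by auto
      then show ?thesis by (elim disjE) (simp_all only: U_eqs cyc f_step simp_thms)
    qed
    have in_T: "U k \<in> pverts T" for k
    proof -
      have "U k \<in> set [u0, u1, u2, u3]" unfolding U_def by (intro nth_mem) simp
      moreover interpret pair_graph T by (rule G)
      have "{u0, u1, u2, u3} \<subseteq> pverts T" using cyc in_arcsD1 by blast
      ultimately show ?thesis by auto
    qed
    show False
    proof (rule one_way_four_walk_not_closed[OF m S, of "\<lambda>k. snd (U k)" "\<lambda>k. X (fst (U k))" "\<lambda>j. h j \<noteq> S j"])
      show "snd (U k) < m" for k
        using in_T[of k] by (auto simp: T cylinder_verts_def)
      show "snd (U 4) = snd (U 0)" "X (fst (U 4)) = X (fst (U 0))"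
        by (simp_all add: U_def)
      fix k :: nat
      assume "k < 4"
      then show "snd (U (Suc k)) = snd (U k) \<and> X (fst (U (Suc k))) = X (fst (U k)) + 1 \<or>
          snd (U (Suc k)) = (snd (U k) + 1) mod m \<and> h (snd (U k)) \<noteq> S (snd (U k)) \<and>
            X (fst (U (Suc k))) = X (fst (U k)) - (if S (snd (U k)) then 1 else 0) \<or>
          snd (U k) = (snd (U (Suc k)) + 1) mod m \<and> \<not> h (snd (U (Suc k))) \<noteq> S (snd (U (Suc k))) \<and>
            X (fst (U (Suc k))) = X (fst (U k)) - (if S (snd (U (Suc k))) then 1 else 0)"
        using U[of k] by (intro step) simp_all
    qed
  qed
qed

theorem theorem3:
  fixes m n :: nat and T :: "(nat \<times> nat) pair_pre_digraph"
  assumes "m \<ge> 4" and "n \<ge> 1" and "triangulation m n T"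
  shows "word_representable T \<longleftrightarrow>
    \<not> contains_induced T (wheel_graph 5) \<and> \<not> contains_induced T (wheel_graph 7)"
proof
  assume "word_representable T"
  then show "\<not> contains_induced T (wheel_graph 5) \<and> \<not> contains_induced T (wheel_graph 7)"
    using not_word_representable_odd_wheel[of T 5] not_word_representable_odd_wheel[of T 7] by auto
next
  assume no: "\<not> contains_induced T (wheel_graph 5) \<and> \<not> contains_induced T (wheel_graph 7)"
  have G: "pair_graph T"
    using assms by (intro pair_graph_triangulation) auto
  from assms(3) show "word_representable T"
  proof (rule triangulation_arcs)
    fix D
    assume T: "pverts T = cylinder_verts m n"
      and arc: "\<And>u v. (u, v) \<in> parcs T \<longleftrightarrow> cylinder_arc m n D u v \<or> cylinder_arc m n D v u"
    have "(D i j \<longleftrightarrow> D i (Suc j)) \<longleftrightarrow> (D (Suc i) j \<longleftrightarrow> D (Suc i) (Suc j))"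
      if "Suc i < n" "Suc j < m" for i j
      using parity_of_interior_vertex[OF assms(1) G T arc that(1), of j] that(2) no by simp
    then show ?thesis
    proof (rule separable_of_parity)
      fix v h
      assume "\<And>i j. i < n \<Longrightarrow> j < m \<Longrightarrow> D i j \<longleftrightarrow> (v i \<longleftrightarrow> h j)"
      then show ?thesis
        by (rule separable_triangulation_word_representable[OF assms(1) G T arc])
    qed
  qed
qed

end
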